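(* Let $q\geq 223$ be a prime power and let $f(x)=x^q+bx^{q^2}$ for some $b\in\mathbb{F}_{q^5}^*$. Then $L_f=\{\langle(x,f(x))\rangle_{\mathbb{F}_{q^5}}: x\in\mathbb{F}_{q^5}^*\}$ is not a maximum scattered linear set of $\mathrm{PG}(1,q^5)$.
   Context: $L_f$ is the $\mathbb{F}_q$-linear set of $\mathrm{PG}(1,q^5)$ associated with the $\mathbb{F}_q$-subspace $U=\{(x,f(x)): x\in\mathbb{F}_{q^5}\}$ of $\mathbb{F}_{q^5}^2$, which has rank $\dim_{\mathbb{F}_q}U=5$. A linear set of rank $r$ is scattered if it has exactly $(q^r-1)/(q-1)$ points (equivalently, $\dim_{\mathbb{F}_q}(U\cap P)=1$ for every point $P$ of it); a scattered linear set of rank $5$ in $\mathrm{PG}(1,q^5)$ is called maximum scattered. *)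

theory Defs
  imports "HOL-Number_Theory.Prime_Powers" "HOL-Library.FuncSet" "HOL-Library.Product_Plus"
begin

(* If q is a prime power and 'a is a field with q^n elements, this is the
   unique subfield of 'a with q elements. *)
definition Fq :: "nat \<Rightarrow> 'a::field set" where
  "Fq q = {c. c ^ q = c}"

definition scale_pair :: "'a::field \<Rightarrow> 'a \<times> 'a \<Rightarrow> 'a \<times> 'a" where
  "scale_pair c v = (c * fst v, c * snd v)"

definition Fq_subspace :: "nat \<Rightarrow> ('a::field \<times> 'a) set \<Rightarrow> bool" where
  "Fq_subspace q U \<longleftrightarrow>
     0 \<in> U \<and> (\<forall>u\<in>U. \<forall>v\<in>U. u + v \<in> U) \<and> (\<forall>c\<in>Fq q. \<forall>u\<in>U. scale_pair c u \<in> U)"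

(* B is a basis of U over Fq: every vector of U has unique coordinates.  The
   coordinate functions are extensional on B, since the unique-existence
   quantifier must not see values outside B. *)
definition Fq_basis :: "nat \<Rightarrow> ('a::field \<times> 'a) set \<Rightarrow> ('a \<times> 'a) set \<Rightarrow> bool" where
  "Fq_basis q B U \<longleftrightarrow>
     finite B \<and> B \<subseteq> U \<and>
     (\<forall>u\<in>U. \<exists>!c. c \<in> B \<rightarrow>\<^sub>E Fq q \<and> u = (\<Sum>v\<in>B. scale_pair (c v) v))"

definition Fq_dim_eq :: "nat \<Rightarrow> ('a::field \<times> 'a) set \<Rightarrow> nat \<Rightarrow> bool" where
  "Fq_dim_eq q U r \<longleftrightarrow> (\<exists>B. Fq_basis q B U \<and> card B = r)"

(* For v nonzero, the point of the projective line over 'a spanned by v, as a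
   one-dimensional 'a-subspace. *)
definition point :: "'a::field \<times> 'a \<Rightarrow> ('a \<times> 'a) set" where
  "point v = range (\<lambda>a. scale_pair a v)"

definition linear_set :: "('a::field \<times> 'a) set \<Rightarrow> ('a \<times> 'a) set set" where
  "linear_set U = {point u | u. u \<in> U \<and> u \<noteq> 0}"

definition linear_set_of_rank :: "nat \<Rightarrow> nat \<Rightarrow> ('a::field \<times> 'a) set set \<Rightarrow> bool" where
  "linear_set_of_rank q r L \<longleftrightarrow>
     (\<exists>U. Fq_subspace q U \<and> Fq_dim_eq q U r \<and> L = linear_set U)"

(* The division is exact. *)
definition scattered_of_rank :: "nat \<Rightarrow> nat \<Rightarrow> ('a::field \<times> 'a) set set \<Rightarrow> bool" where
  "scattered_of_rank q r L \<longleftrightarrow>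
     linear_set_of_rank q r L \<and> card L = (q ^ r - 1) div (q - 1)"

(* Meant for a field 'a with q^5 elements. *)
definition maximum_scattered :: "nat \<Rightarrow> ('a::field \<times> 'a) set set \<Rightarrow> bool" where
  "maximum_scattered q L \<longleftrightarrow> scattered_of_rank q 5 L"

definition L_graph :: "('a::field \<Rightarrow> 'a) \<Rightarrow> ('a \<times> 'a) set set" where
  "L_graph f = {point (x, f x) | x. x \<noteq> 0}"

lemma L_graph_eq_linear_set:
  assumes "f 0 = 0"
  shows "L_graph f = linear_set {(x, f x) | x. True}"
  using assms by (auto simp: L_graph_def linear_set_def zero_prod_def)

end

theory Submission
  imports Defs "HOL-Algebra.Algebraic_Closure_Type" "HOL-Number_Theory.Residues"
begin

text \<open>
  Let $f(x) = x^q + b x^{q^2}$. A point of $L_f$ that contains $(z, f(z))$ for two vectors $z$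
  independent over $\mathbb{F}_q$ amounts to a scalar $l$ for which the $q$-linear equation
  $b z^{q^2} + z^q = l z$ has all its $q^2$ solutions in $\mathbb{F}_{q^5}$. Such a point uses up
  too many of the $q^5 - 1$ nonzero arguments for $L_f$ to have $(q^5 - 1)/(q - 1)$ points.

  To find $l$, regard the equation and its conjugates as a second-order recurrence for
  $z_i = z^{q^i}$. All solutions lie in $\mathbb{F}_{q^5}$ as soon as five steps of this recurrence
  act as the identity. Substituting $l_i b_{i-1} = -(1 + x_i)$ with $x_i = x^{q^i}$, five steps
  act as a scalar whenever $x_{i-1} x_{i+1} = 1 + x_i$ (lemma \<open>pentagon_monodromy\<close>). The scalar
  is then $-N(x)/N(b)$, where $N$ is the norm to $\mathbb{F}_q$. What remains is to find $x$ with
  $x \cdot x^{q^2} = 1 + x^q$ and $N(x) = c$, where $c = -N(b)$ is a given nonzero element of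
  $\mathbb{F}_q$.

  Under the recurrence the norm condition becomes $(1 + x)(1 + y)(1 + x + y) = c x y$ with $y = x^q$.
  Geometrically this asks for a rational point on a twisted genus-one curve; counting the roots of
  a single polynomial provides one (lemma \<open>exists_pentagon_point\<close>). The curve has degree two over the
  $y$-line, and for a root $x$ of the resulting equation of degree $2q + 1$ in $x$ both $x$ and
  $x^{q^2}$ lie over $y = x^q$. Either they are the two points over $y$, whose product is $1 + y$, and
  $x$ is as required; or they coincide, and $x$ is a simple root in $\mathbb{F}_{q^2}$. Roots of
  the latter kind number at most $2q$, because the trace of $x$ to $\mathbb{F}_q$ determines $x$ up
  to conjugation.
\<close>

section \<open>Finite fields inside their algebraic closure\<close>

lemma finite_field_power_card:
  fixes a :: "'a::{field,finite}"
  shows "a ^ card (UNIV :: 'a set) = a"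
proof (cases "a = 0")
  case True
  then show ?thesis by (simp add: power_0_left)
next
  case False
  let ?S = "UNIV - {0 :: 'a}"
  have "bij_betw (\<lambda>x. a * x) ?S ?S"
    by (rule bij_betw_byWitness[where f' = "\<lambda>x. x / a"]) (use False in auto)
  then have "(\<Prod>x\<in>?S. a * x) = (\<Prod>x\<in>?S. x)"
    by (rule prod.reindex_bij_betw)
  then have "a ^ card ?S * (\<Prod>x\<in>?S. x) = (\<Prod>x\<in>?S. x)"
    by (simp add: prod.distrib)
  moreover have "(\<Prod>x\<in>?S. x) \<noteq> 0"
    by simp
  ultimately have "a ^ card ?S = 1"
    by simp
  moreover have "card (UNIV :: 'a set) = Suc (card ?S)"
    by (rule card.remove) simp_all
  ultimately show ?thesis
    by (simp only: power_Suc mult_1_right)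
qed

lemma CHAR_of_finite_field_primepow_card:
  assumes "primepow q" and card: "card (UNIV :: 'a::{field,finite} set) = q ^ n"
  obtains k where "Factorial_Ring.prime CHAR('a)" "k > 0" "q = CHAR('a) ^ k"
proof -
  obtain p k where p: "Factorial_Ring.prime p" "k > 0" "q = p ^ k"
    using \<open>primepow q\<close> by (auto simp: primepow_def)
  have "CHAR('a) > 0"
    by (simp add: finite_imp_CHAR_pos)
  then have pc: "Factorial_Ring.prime CHAR('a)"
    by (rule prime_CHAR_semidom)
  have "CHAR('a) dvd (p ^ k) ^ n"
    using CHAR_dvd_CARD[where 'a = 'a] unfolding card p(3) .
  then have "CHAR('a) dvd p"
    using pc prime_dvd_power by blast
  then have "CHAR('a) = p"
    using pc p(1) primes_dvd_imp_eq by blast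
  then show ?thesis using that pc p by blast
qed

lemma range_to_ac_finite_field:
  fixes x :: "'a::{field,finite} alg_closure"
  shows "x \<in> range (to_ac :: 'a \<Rightarrow> _) \<longleftrightarrow> x ^ card (UNIV :: 'a set) = x"
proof -
  define n where "n = card (UNIV :: 'a set)"
  have "card {0, 1 :: 'a} \<le> n"
    unfolding n_def by (rule card_mono) simp_all
  then have n: "n \<ge> 2" by simp
  define P where "P = monom (1 :: 'a alg_closure) n + - [:0, 1:]"
  have "degree P = degree (monom (1 :: 'a alg_closure) n)"
    unfolding P_def by (rule degree_add_eq_left) (use n in \<open>simp add: degree_monom_eq\<close>)
  then have "degree P = n" by (simp add: degree_monom_eq)
  moreover from this have "P \<noteq> 0" using n by auto
  moreover have P: "{x. x ^ n = x} = {x. poly P x = 0}"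
    by (auto simp: P_def poly_monom)
  ultimately have bound: "card {x :: 'a alg_closure. x ^ n = x} \<le> n"
    and fin: "finite {x :: 'a alg_closure. x ^ n = x}"
    using card_poly_roots_bound[of P] poly_roots_finite[of P] by auto
  have sub: "range (to_ac :: 'a \<Rightarrow> _) \<subseteq> {x. x ^ n = x}"
    by (auto simp: n_def finite_field_power_card simp flip: to_ac_power)
  have "card (range (to_ac :: 'a \<Rightarrow> _)) = n"
    unfolding n_def by (rule card_image) (rule inj_to_ac)
  then have "range (to_ac :: 'a \<Rightarrow> _) = {x. x ^ n = x}"
    using card_subset_eq[OF fin sub] bound card_mono[OF fin sub] by simp
  then show ?thesis unfolding n_def by blast
qed

lemma card_roots_of_separable_poly:
  fixes p :: "'k::alg_closed_field poly"
  assumes "p \<noteq> 0" and simple: "\<And>x. poly p x = 0 \<Longrightarrow> poly (pderiv p) x \<noteq> 0"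
  shows "card {x. poly p x = 0} = degree p"
proof -
  obtain A where A: "size A = degree p" "p = smult (lead_coeff p) (\<Prod>x\<in>#A. [:- x, 1:])"
    using alg_closed_imp_factorization[OF assms(1)] by blast
  have roots: "{x. poly p x = 0} = set_mset A"
    by (subst A(2)) (use \<open>p \<noteq> 0\<close> in \<open>auto simp: poly_prod_mset\<close>)
  have "count A x = 1" if x: "x \<in># A" for x
  proof (rule ccontr)
    assume "count A x \<noteq> 1"
    obtain C where C: "A = add_mset x C"
      using x multi_member_split by metis
    with \<open>count A x \<noteq> 1\<close> have "x \<in># C"
      by (simp add: count_eq_zero_iff[symmetric] del: count_eq_zero_iff)
    then obtain B where B: "A = add_mset x (add_mset x B)"
      using C multi_member_split by metis
    define r where "r = smult (lead_coeff p) (\<Prod>y\<in>#B. [:- y, 1:])"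
    have p: "p = [:- x, 1:] * ([:- x, 1:] * r)"
      by (subst A(2)) (simp add: B r_def)
    have "poly (pderiv p) x = 0"
      by (subst p, subst pderiv_mult) simp
    moreover have "poly p x = 0"
      by (subst p) simp
    ultimately show False using simple by blast
  qed
  then have "(\<Sum>x\<in>set_mset A. count A x) = (\<Sum>x\<in>set_mset A. 1)"
    by (intro sum.cong) auto
  then have "size A = card (set_mset A)"
    unfolding size_multiset_overloaded_eq by (simp only: card_eq_sum)
  then show ?thesis using A(1) roots by (simp only:)
qed

text \<open>
  This transfers root counts from the algebraic closure: every root is fixed by the Frobenius
  automorphism that cuts out the finite field, so no root is lost on passing down to it.
\<close>
lemma card_roots_in_finite_field:
  fixes P :: "'a::{field,finite} alg_closure poly" and Q :: "'a \<Rightarrow> bool"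
  assumes "P \<noteq> 0" and "\<And>x. poly P x = 0 \<Longrightarrow> poly (pderiv P) x \<noteq> 0"
    and "\<And>x. poly P x = 0 \<Longrightarrow> x ^ card (UNIV :: 'a set) = x"
    and Q: "\<And>a. Q a \<longleftrightarrow> poly P (to_ac a) = 0"
  shows "card {a. Q a} = degree P"
proof -
  have "to_ac ` {a. Q a} = {x. poly P x = 0}"
    using assms(3) Q by (fastforce simp flip: range_to_ac_finite_field)
  then have "card {a. Q a} = card {x. poly P x = 0}"
    using card_image[of to_ac "{a. Q a}"] inj_to_ac by (metis inj_on_subset subset_UNIV)
  then show ?thesis using card_roots_of_separable_poly[OF assms(1,2)] by simp
qed

section \<open>The pentagon recurrence\<close>

text \<open>
  Every nowhere vanishing solution of $x_i x_{i+2} = 1 + x_{i+1}$, called a pentagon sequence below,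
  has period 5 (Gauss's pentagramma mirificum).
  For a sequence $x_i = x^{q^i}$ of conjugates this forces $x$ into $\mathbb{F}_{q^5}$.
\<close>
lemma pentagon_recurrence:
  fixes x :: "nat \<Rightarrow> 'k::field"
  assumes "\<And>i. x i \<noteq> 0" and rec: "\<And>i. x i * x (i + 2) = 1 + x (i + 1)"
  shows "x 4 * x 1 = 1 + x 0" "x 5 = x 0"
proof -
  have r: "x 0 * x 2 = 1 + x 1" "x 1 * x 3 = 1 + x 2" "x 2 * x 4 = 1 + x 3" "x 3 * x 5 = 1 + x 4"
    using rec[of 0] rec[of 1] rec[of 2] rec[of 3] by (simp_all add: numeral_eq_Suc)
  have "x 0 * x 2 * (x 4 * x 1 - (1 + x 0)) = 0"
    using r by Groebner_Basis.algebra
  then show 1: "x 4 * x 1 = 1 + x 0" using assms(1) by simp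
  have "x 1 * x 3 * (x 5 - x 0) = 0"
    using r 1 by Groebner_Basis.algebra
  then show "x 5 = x 0" using assms(1) by simp
qed

text \<open>
  Five steps of a second-order linear recurrence express $w_5$ as a combination of $w_0$ and $w_1$.
  For coefficients coming from a pentagon sequence, the two summands $-w_4$ and $-(1 + x_3) w_3$
  both acquire the factor $x_1 x_2 x_4$, and the contributions of $w_1$ cancel.
\<close>
lemma pentagon_monodromy:
  fixes x w :: "nat \<Rightarrow> 'k::field"
  assumes "\<And>i. x i \<noteq> 0" and "\<And>i. x i * x (i + 2) = 1 + x (i + 1)"
    and w: "\<And>i. i < 4 \<Longrightarrow> w (i + 2) = - (1 + x i) * w i - w (i + 1)"
  shows "w 5 = - (x 0 * x 1 * x 2 * x 3 * x 4) * w 0"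
proof -
  have r: "x 0 * x 2 = 1 + x 1" "x 1 * x 3 = 1 + x 2" "x 2 * x 4 = 1 + x 3" "x 4 * x 1 = 1 + x 0"
    using assms(2)[of 0] assms(2)[of 1] assms(2)[of 2] pentagon_recurrence[OF assms(1,2)]
    by (simp_all add: numeral_eq_Suc)
  have s: "x 3 * x 0 = 1 + x 4"
    using assms(2)[of 3] pentagon_recurrence(2)[OF assms(1,2)] by simp
  have w': "w 2 = - (1 + x 0) * w 0 - w 1" "w 3 = - (1 + x 1) * w 1 - w 2"
    "w 4 = - (1 + x 2) * w 2 - w 3" "w 5 = - (1 + x 3) * w 3 - w 4"
    using w[of 0] w[of 1] w[of 2] w[of 3] by (simp_all add: numeral_eq_Suc)
  have w3: "w 3 = x 1 * (x 4 * w 0 - w 1)"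
    using w' r by Groebner_Basis.algebra
  have w4: "w 4 = x 1 * x 2 * x 4 * (w 0 + w 1)"
    using w' w3 r by Groebner_Basis.algebra
  show ?thesis using w'(4) w3 w4 r s by Groebner_Basis.algebra
qed

section \<open>Conjugate points on the pentagon curve\<close>

text \<open>
  For fixed $y$, the equation of the pentagon curve is quadratic in its other coordinate, with
  leading coefficient $1 + y$ and constant term $(1 + y)^2$. Hence its two roots have product
  $1 + y$. The roots $x$ and $z$ below exhaust this quadratic in two situations: when they differ,
  and when the derivative vanishes at $x$.
\<close>
lemma pentagon_curve_other_intersection:
  fixes x y z c :: "'k::field"
  assumes c: "c \<noteq> 0" and "x \<noteq> 0" "y \<noteq> 0"
    and 1: "(1 + x) * (1 + y) * (1 + x + y) = c * x * y"
    and 2: "(1 + y) * (1 + z) * (1 + y + z) = c * y * z"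
    and 3: "x \<noteq> z \<or> (1 + y) * (2 + 2 * x + y) = c * y"
  shows "x * z = 1 + y"
proof -
  have y1: "1 + y \<noteq> 0"
    using 1 assms(1-3) by auto
  have "(1 + y) * (x * z - (1 + y)) = 0"
  proof (cases "x = z")
    case True
    with 3 have d: "(1 + y) * (2 + 2 * x + y) = c * y"
      by simp
    show ?thesis using 1 d unfolding True[symmetric] by Groebner_Basis.algebra
  next
    case False
    have "(x - z) * ((1 + y) * (x + z) + (1 + y) * (2 + y) - c * y) = 0"
      using 1 2 by Groebner_Basis.algebra
    with False have s: "(1 + y) * (x + z) + (1 + y) * (2 + y) - c * y = 0"
      by simp
    show ?thesis using 1 s by Groebner_Basis.algebra
  qed
  with y1 show ?thesis by simp
qed

text \<open>
  The product $c$ of five consecutive terms of a pentagon sequence starting with $x, y$ satisfies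
  $(1 + x)(1 + y)(1 + x + y) = c x y$. With $y = x^q$ this is an equation of degree $2q + 1$ in
  $x$. By the previous lemma the only roots that do not continue to a pentagon sequence under
  $x \mapsto x^q$ are simple roots lying in $\mathbb{F}_{q^2}$. For such a root the trace
  $t = x + x^q$ lies in $\mathbb{F}_q$, and the equation determines the norm $x \cdot x^q$ from $t$,
  so at most two of these roots share a trace. There are thus at most $2q$ of them, one too few
  to account for all roots.
\<close>
lemma exists_pentagon_point:
  fixes c :: "'k::alg_closed_field"
  assumes frob: "\<And>x y :: 'k. (x + y) ^ q = x ^ q + y ^ q"
    and "of_nat q = (0 :: 'k)" and q: "q \<ge> 2"
    and c: "c \<noteq> 0" "c ^ q = c"
  obtains x where "x \<noteq> 0" "x * (x ^ q) ^ q = 1 + x ^ q"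
    "(1 + x) * (1 + x ^ q) * (1 + x + x ^ q) = c * x * x ^ q"
proof -
  define H where
    "H = [:1, 1:] * (1 + monom 1 q) * ([:1, 1:] + monom 1 q) - monom c (Suc q)"
  have H: "poly H x = (1 + x) * (1 + x ^ q) * (1 + x + x ^ q) - c * x * x ^ q" for x
    by (simp add: H_def poly_monom algebra_simps)
  have dH: "poly (pderiv H) x = (1 + x ^ q) * (2 + 2 * x + x ^ q) - c * x ^ q" for x
  proof -
    have "pderiv (monom 1 q) = (0 :: 'k poly)" "pderiv (monom c (Suc q)) = monom c q"
      using assms(2) by (simp_all add: pderiv_monom)
    then show ?thesis
      by (simp add: H_def pderiv_mult pderiv_add pderiv_diff pderiv_pCons poly_monom
          algebra_simps)
  qed
  have degH: "degree H = 2 * q + 1"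
  proof -
    have m: "degree (monom (1 :: 'k) q) = q"
      by (simp add: degree_monom_eq)
    have f: "degree (1 + monom (1 :: 'k) q) = q" "degree ([:1, 1:] + monom (1 :: 'k) q) = q"
      using q m by (simp_all add: degree_add_eq_right)
    then have nz: "1 + monom (1 :: 'k) q \<noteq> 0" "[:1, 1:] + monom (1 :: 'k) q \<noteq> 0"
      using q by auto
    have "degree (P * Q * R) = degree P + degree Q + degree R"
      if "P \<noteq> 0" "Q \<noteq> 0" "R \<noteq> 0" for P Q R :: "'k poly"
      using that by (simp add: degree_mult_eq)
    from this[OF _ nz, of "[:1, 1:]"]
    have d: "degree ([:1, 1:] * (1 + monom (1 :: 'k) q) * ([:1, 1:] + monom 1 q)) = 2 * q + 1"
      unfolding f by simp
    have "degree (- monom c (Suc q)) < 2 * q + 1"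
      using q degree_monom_le[of c "Suc q"] by simp
    then have "degree ([:1, 1:] * (1 + monom (1 :: 'k) q) * ([:1, 1:] + monom 1 q)
        + - monom c (Suc q)) = 2 * q + 1"
      unfolding d[symmetric] by (rule degree_add_eq_left)
    then show ?thesis unfolding H_def diff_conv_add_uminus .
  qed
  have Hnz: "H \<noteq> 0" using degH by auto
  have "\<exists>x. poly H x = 0 \<and> x * (x ^ q) ^ q = 1 + x ^ q"
  proof (rule ccontr)
    assume none: "\<nexists>x. poly H x = 0 \<and> x * (x ^ q) ^ q = 1 + x ^ q"
    \<comment> \<open>a double root, or one with $x \neq x^{q^2}$, would satisfy $x \cdot x^{q^2} = 1 + x^q$\<close>
    have root: "x \<noteq> 0 \<and> (x ^ q) ^ q = x \<and> poly (pderiv H) x \<noteq> 0" if x: "poly H x = 0" for x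
    proof -
      define y z where "y = x ^ q" and "z = y ^ q"
      have x0: "x \<noteq> 0" using x q by (auto simp: H power_0_left)
      then have y0: "y \<noteq> 0" by (simp add: y_def)
      have 1: "(1 + x) * (1 + y) * (1 + x + y) = c * x * y"
        using x by (simp add: H y_def)
      then have "((1 + x) * (1 + y) * (1 + x + y)) ^ q = (c * x * y) ^ q"
        by simp
      then have 2: "(1 + y) * (1 + z) * (1 + y + z) = c * y * z"
        by (simp add: power_mult_distrib frob c y_def z_def)
      have "x = z \<and> (1 + y) * (2 + 2 * x + y) \<noteq> c * y"
        using pentagon_curve_other_intersection[OF c(1) x0 y0 1 2] none x
        by (auto simp: y_def z_def)
      then show ?thesis using x0 by (auto simp: dH y_def z_def)
    qed
    define R where "R = {x. poly H x = 0}"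
    define T where "T = {t :: 'k. t ^ q = t}"
    have cardR: "card R = 2 * q + 1"
      unfolding R_def using card_roots_of_separable_poly[OF Hnz] root degH by auto
    have T: "finite T" "card T \<le> q"
    proof -
      define P where "P = monom (1 :: 'k) q + - [:0, 1:]"
      have "degree P = q"
        unfolding P_def using q by (subst degree_add_eq_left) (simp_all add: degree_monom_eq)
      moreover from this have "P \<noteq> 0" using q by auto
      moreover have "T = {t. poly P t = 0}"
        by (auto simp: T_def P_def poly_monom)
      ultimately show "finite T" "card T \<le> q"
        using card_poly_roots_bound[of P] poly_roots_finite[of P] by auto
    qed
    have sub: "R \<subseteq> (\<Union>t\<in>T. {x \<in> R. x + x ^ q = t})"
    proof
      fix x assume "x \<in> R"
      then have "(x + x ^ q) ^ q = x + x ^ q"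
        using root[of x] by (simp add: R_def frob add.commute)
      with \<open>x \<in> R\<close> show "x \<in> (\<Union>t\<in>T. {x \<in> R. x + x ^ q = t})"
        by (simp add: T_def)
    qed
    have fibre: "card {x \<in> R. x + x ^ q = t} \<le> 2" for t
    proof -
      \<comment> \<open>the norm $x \cdot x^q$ of a root with trace $t$\<close>
      define n where "n = (1 + t)\<^sup>2 / (c - 1 - t)"
      have "{x \<in> R. x + x ^ q = t} \<subseteq> {x. poly [:n, - t, 1:] x = 0}"
      proof
        fix x assume x: "x \<in> {x \<in> R. x + x ^ q = t}"
        have t: "x ^ q = t - x" using x by (auto simp: eq_diff_eq add.commute)
        have h: "(1 + x) * (1 + (t - x)) * (1 + t) = c * x * (t - x)"
          using x by (simp add: R_def H t)
        have e: "x * (t - x) * (c - 1 - t) = (1 + t)\<^sup>2"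
          using h by Groebner_Basis.algebra
        have "c - 1 - t \<noteq> 0"
        proof
          assume "c - 1 - t = 0"
          moreover from this have "1 + t = 0" using e by simp
          ultimately show False using c(1) by (simp add: algebra_simps)
        qed
        then have "x * (t - x) = n"
          using e by (simp add: n_def field_simps)
        then show "x \<in> {x. poly [:n, - t, 1:] x = 0}"
          by (simp add: algebra_simps)
      qed
      then have "card {x \<in> R. x + x ^ q = t} \<le> card {x. poly [:n, - t, 1:] x = 0}"
        by (intro card_mono poly_roots_finite) auto
      also have "\<dots> \<le> 2"
        using card_poly_roots_bound[of "[:n, - t, 1:]"] by simp
      finally show ?thesis .
    qed
    have "finite R" unfolding R_def using Hnz by (rule poly_roots_finite)
    then have "card R \<le> card (\<Union>t\<in>T. {x \<in> R. x + x ^ q = t})"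
      using sub T(1) by (intro card_mono) auto
    also have "\<dots> \<le> (\<Sum>t\<in>T. card {x \<in> R. x + x ^ q = t})"
      using T(1) by (rule card_UN_le)
    also have "\<dots> \<le> (\<Sum>t\<in>T. 2)"
      by (intro sum_mono fibre)
    also have "\<dots> \<le> 2 * q"
      using T(2) by simp
    finally show False using cardR by simp
  qed
  then obtain x where x: "poly H x = 0" "x * (x ^ q) ^ q = 1 + x ^ q"
    by blast
  have "x \<noteq> 0" using x(1) q by (auto simp: H power_0_left)
  then show ?thesis using that x by (simp add: H)
qed

section \<open>A q-linear equation with all its solutions in the field\<close>

context
  fixes q k :: nat
  assumes char: "Factorial_Ring.prime CHAR('a::{field,finite})" and k: "k > 0" and q_def: "q = CHAR('a) ^ k"
    and card_a: "card (UNIV :: 'a set) = q ^ 5"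
begin

lemma q_ge_2: "q \<ge> 2"
proof -
  have "CHAR('a) ^ 1 \<le> q"
    unfolding q_def using k char by (intro power_increasing) (auto simp: prime_gt_0_nat Suc_leI)
  then show ?thesis using prime_ge_2_nat[OF char] by simp
qed

lemma of_nat_q: "of_nat q = (0 :: 'a alg_closure)"
proof -
  have "of_nat CHAR('a) = (0 :: 'a alg_closure)"
    by (metis of_nat_CHAR CHAR_alg_closure)
  then show ?thesis using k by (simp add: q_def)
qed

lemma frobenius_add: "(x + y :: 'a alg_closure) ^ (q ^ i) = x ^ (q ^ i) + y ^ (q ^ i)"
  by (rule freshmans_dream'[where n = "k * i"]) (simp_all add: char q_def power_mult)

lemma card_Fq: "card (Fq q :: 'a set) = q"
proof -
  define P where "P = monom (1 :: 'a alg_closure) q + - [:0, 1:]"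
  have "degree P = degree (monom (1 :: 'a alg_closure) q)"
    unfolding P_def
    by (rule degree_add_eq_left) (use q_ge_2 in \<open>simp add: degree_monom_eq\<close>)
  then have deg: "degree P = q" by (simp add: degree_monom_eq)
  have "card {c :: 'a. c ^ q = c} = degree P"
  proof (rule card_roots_in_finite_field)
    show "P \<noteq> 0" using deg q_ge_2 by auto
    show "poly (pderiv P) x \<noteq> 0" for x
      by (simp add: P_def pderiv_add pderiv_minus pderiv_monom pderiv_pCons of_nat_q)
    show "x ^ card (UNIV :: 'a set) = x" if "poly P x = 0" for x
    proof -
      have "x ^ q = x" using that by (simp add: P_def poly_monom)
      then have "x ^ (q ^ i) = x" for i
        by (induction i) (simp_all add: power_mult)
      then show ?thesis by (simp add: card_a)
    qed
    show "c ^ q = c \<longleftrightarrow> poly P (to_ac c) = 0" for c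
      by (simp add: P_def poly_monom flip: to_ac_power)
  qed
  then show ?thesis by (simp add: Fq_def deg)
qed

text \<open>
  Write $b_i$, $x_i$, $l_i$, $z_i$ for the $q^i$-th powers of $b$, $x$, $l$, $z$. The equation
  for $z$ and its conjugates form the recurrence $b_i z_{i+2} = l_i z_i - z_{i+1}$. Multiplying
  $z_i$ by $b_4 b_5 \cdots b_{i+3}$ normalises the coefficient of $z_{i+1}$ to $-1$ and turns that
  of $z_i$ into $l_i b_{i+4}$. Choosing $l$ so that this equals $-(1 + x_i)$ for a pentagon sequence
  makes the monodromy scalar, and the norm condition on $x$ makes the scalar equal to one:
  every solution in the algebraic closure satisfies $z^{q^5} = z$.
\<close>
lemma exists_large_eigenspace:
  fixes b :: 'a
  assumes b: "b \<noteq> 0"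
  obtains l where "card {z. b * z ^ (q ^ 2) + z ^ q = l * z} = q ^ 2"
proof -
  define B where "B i = to_ac b ^ (q ^ i)" for i
  have B0: "B i \<noteq> 0" for i using b by (simp add: B_def)
  have B5: "B (i + 5) = B i" for i
  proof -
    have "to_ac b ^ (q ^ 5) = to_ac b"
      by (simp add: finite_field_power_card flip: to_ac_power card_a)
    moreover have "B (i + 5) = (to_ac b ^ (q ^ 5)) ^ (q ^ i)"
      by (simp add: B_def power_add mult.commute flip: power_mult)
    ultimately show ?thesis by (simp add: B_def)
  qed
  have Bq: "B i ^ q = B (Suc i)" for i
    by (simp add: B_def mult.commute flip: power_mult)
  define c where "c = - (B 0 * B 1 * B 2 * B 3 * B 4)"
  have c0: "c \<noteq> 0" using B0 by (simp add: c_def)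
  have cq: "c ^ q = c"
  proof -
    define M where "M = B 0 * B 1 * B 2 * B 3 * B 4"
    have "c ^ q + M ^ q = (c + M) ^ q"
      using frobenius_add[of c M 1] by simp
    also have "c + M = 0" by (simp add: c_def M_def)
    finally have "c ^ q + M ^ q = 0"
      using q_ge_2 by (simp add: power_0_left)
    moreover have "M ^ q = B 1 * B 2 * B 3 * B 4 * B 5"
      using Bq[of 0] Bq[of 1] Bq[of 2] Bq[of 3] Bq[of 4]
      by (simp add: M_def power_mult_distrib eval_nat_numeral)
    moreover have "B 5 = B 0" using B5[of 0] by simp
    ultimately show ?thesis unfolding c_def by (simp add: eq_neg_iff_add_eq_0 mult_ac)
  qed
  obtain x where x: "x \<noteq> 0" "x * (x ^ q) ^ q = 1 + x ^ q"
    "(1 + x) * (1 + x ^ q) * (1 + x + x ^ q) = c * x * x ^ q"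
    using exists_pentagon_point[OF _ of_nat_q q_ge_2 c0 cq] frobenius_add[of _ _ 1] by auto
  define Y where "Y = (\<lambda>i. x ^ (q ^ i))"
  have Y0: "Y i \<noteq> 0" for i using x(1) by (simp add: Y_def)
  have rec: "Y i * Y (i + 2) = 1 + Y (i + 1)" for i
  proof -
    have "(x * (x ^ q) ^ q) ^ (q ^ i) = (1 + x ^ q) ^ (q ^ i)"
      using x(2) by simp
    then show ?thesis
      by (simp add: Y_def frobenius_add power_mult_distrib power2_eq_square mult_ac
          flip: power_mult)
  qed
  note Y41 = pentagon_recurrence(1)[OF Y0 rec] and Y5 = pentagon_recurrence(2)[OF Y0 rec]
  have norm: "Y 0 * Y 1 * Y 2 * Y 3 * Y 4 = c"
  proof -
    have "(1 + Y 0) * (1 + Y 1) * (1 + Y 0 + Y 1) = c * Y 0 * Y 1"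
      using x(3) by (simp add: Y_def)
    moreover have "Y 0 * Y 2 = 1 + Y 1" "Y 1 * Y 3 = 1 + Y 2"
      using rec[of 0] rec[of 1] by (simp_all add: numeral_eq_Suc)
    ultimately have "Y 0 * Y 1 * (Y 0 * Y 1 * Y 2 * Y 3 * Y 4 - c) = 0"
      using Y41 by Groebner_Basis.algebra
    then show ?thesis using Y0 by simp
  qed
  have "x ^ card (UNIV :: 'a set) = x"
    using Y5 by (simp add: Y_def card_a)
  then obtain a where a: "x = to_ac a"
    using range_to_ac_finite_field[of x] by blast
  \<comment> \<open>$b^{q^4}$ is the conjugate of $b$ preceding $b$ itself\<close>
  define l where "l = - (1 + a) / b ^ (q ^ 4)"
  define L where "L i = to_ac l ^ (q ^ i)" for i
  have LB: "L i * B (i + 4) = - (1 + Y i)" for i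
  proof -
    have "to_ac l * B 4 = - (1 + x)"
      using b by (simp add: l_def a B_def)
    then have "(to_ac l * B 4 + (1 + x)) ^ (q ^ i) = 0"
      using q_ge_2 by simp
    then have "(to_ac l * B 4) ^ (q ^ i) + (1 + Y i) = 0"
      by (simp add: frobenius_add Y_def)
    moreover have "(to_ac l * B 4) ^ (q ^ i) = L i * B (i + 4)"
      by (simp add: L_def B_def power_mult_distrib power_add mult_ac flip: power_mult)
    ultimately show ?thesis by (metis eq_neg_iff_add_eq_0)
  qed
  have l0: "l \<noteq> 0"
  proof
    assume "l = 0"
    then have "- (1 + Y 0) = 0" using LB[of 0] by (simp add: L_def del: minus_add_distrib)
    then have "1 + Y 0 = 0" by (simp only: neg_equal_0_iff_equal)
    then show False using Y41 Y0 by (metis mult_eq_0_iff)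
  qed
  define P where "P = monom (to_ac b) (q ^ 2) + (monom 1 q - monom (to_ac l) 1)"
  have polyP: "poly P z = to_ac b * z ^ (q ^ 2) + z ^ q - to_ac l * z" for z
    by (simp add: P_def poly_monom)
  have "degree P = degree (monom (to_ac b) (q ^ 2))"
    unfolding P_def
  proof (rule degree_add_eq_left)
    have "q < q ^ 2" using q_ge_2 by (simp add: power2_eq_square)
    moreover have "degree (monom (1 :: 'a alg_closure) q - monom (to_ac l) 1) \<le> q"
      using q_ge_2 by (intro degree_diff_le) (simp_all add: degree_monom_eq l0)
    ultimately show "degree (monom 1 q - monom (to_ac l) 1) < degree (monom (to_ac b) (q ^ 2))"
      using b by (simp add: degree_monom_eq)
  qed
  then have deg: "degree P = q ^ 2"
    using b by (simp add: degree_monom_eq)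
  have "card {z. b * z ^ (q ^ 2) + z ^ q = l * z} = degree P"
  proof (rule card_roots_in_finite_field)
    show "P \<noteq> 0" using deg q_ge_2 by auto
    show "poly (pderiv P) z \<noteq> 0" for z
      using l0 q_ge_2
      by (simp add: P_def pderiv_add pderiv_diff pderiv_monom of_nat_q poly_monom)
    show "b * z ^ (q ^ 2) + z ^ q = l * z \<longleftrightarrow> poly P (to_ac z) = 0" for z
      unfolding polyP by (simp flip: to_ac_power to_ac_mult to_ac_add to_ac_diff)
  next
    fix z assume "poly P z = 0"
    then have z: "to_ac b * z ^ (q ^ 2) + z ^ q = to_ac l * z"
      by (simp add: polyP)
    define Z where "Z i = z ^ (q ^ i)" for i
    have Zrec: "B i * Z (i + 2) + Z (i + 1) = L i * Z i" for i
    proof -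
      have "(to_ac b * z ^ (q ^ 2) + z ^ q) ^ (q ^ i) = (to_ac l * z) ^ (q ^ i)"
        using z by simp
      then show ?thesis
        by (simp add: Z_def B_def L_def frobenius_add power_mult_distrib power_add
            power2_eq_square mult_ac
            flip: power_mult)
    qed
    \<comment> \<open>modulo 5, the index $m + 4$ stands for $m - 1$\<close>
    define w where "w j = (\<Prod>m<j. B (m + 4)) * Z j" for j
    have "w (i + 2) = - (1 + Y i) * w i - w (i + 1)" for i
    proof -
      have "w (i + 2) = (\<Prod>m<i. B (m + 4)) * B (i + 4) * (B i * Z (i + 2))"
        using B5[of i] by (simp add: w_def add.commute mult_ac)
      also have "B i * Z (i + 2) = L i * Z i - Z (i + 1)"
        using Zrec[of i] by (simp add: eq_diff_eq)
      also have "(\<Prod>m<i. B (m + 4)) * B (i + 4) * (L i * Z i - Z (i + 1))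
          = (L i * B (i + 4)) * w i - w (i + 1)"
        by (simp add: w_def algebra_simps)
      finally show ?thesis unfolding LB .
    qed
    from pentagon_monodromy[OF Y0 rec this]
    have "w 5 = - c * Z 0"
      unfolding norm by (simp add: w_def)
    moreover have "w 5 = - c * Z 5"
    proof -
      have "(\<Prod>m<5. B (m + 4)) = B 4 * B 5 * B 6 * B 7 * B 8"
        by (simp add: eval_nat_numeral)
      also have "\<dots> = - c"
        using B5[of 0] B5[of 1] B5[of 2] B5[of 3] by (simp add: c_def mult_ac)
      finally show ?thesis by (simp add: w_def)
    qed
    ultimately have "Z 5 = Z 0" using c0 by simp
    then show "z ^ card (UNIV :: 'a set) = z" by (simp add: Z_def card_a)
  qed
  then show ?thesis using that deg by metis
qed

end

section \<open>Counting the points of the linear set\<close>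

lemma point_scale_pair:
  fixes c :: "'b::field"
  assumes "c \<noteq> 0"
  shows "point (scale_pair c v) = point v"
proof -
  have *: "scale_pair a (scale_pair c v) = scale_pair (a * c) v" for a
    by (simp add: scale_pair_def mult_ac)
  have "range (\<lambda>a. a * c) = UNIV"
    using assms by (intro surjI[of _ "\<lambda>a. a / c"]) simp
  then have "(\<lambda>a. scale_pair a v) ` range (\<lambda>a. a * c) = range (\<lambda>a. scale_pair a v)"
    by (simp only:)
  then show ?thesis by (simp only: point_def * image_image)
qed

text \<open>
  All nonzero solutions $z$ of $f(z) = l z$ give the same point $\langle (1, l) \rangle$. Every
  point arises from at least $q - 1$ values of $x$, by scaling with $\mathbb{F}_q^*$, so a
  point arising from $q^2 - 1$ values leaves too few values for the remaining points.
\<close>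
lemma L_graph_not_maximum_scattered:
  fixes b :: "'a::{field,finite}"
  assumes char: "Factorial_Ring.prime CHAR('a)" "k > 0" "q = CHAR('a) ^ k"
    and card_a: "card (UNIV :: 'a set) = q ^ 5"
    and b: "b \<noteq> 0"
  shows "\<not> maximum_scattered q (L_graph (\<lambda>x. x ^ q + b * x ^ (q ^ 2)))"
proof
  note q_ge_2 = q_ge_2[OF char card_a] and card_Fq = card_Fq[OF char card_a]
  define f where "f x = x ^ q + b * x ^ (q ^ 2)" for x
  define p where "p x = point (x, f x)" for x
  define S where "S = UNIV - {0 :: 'a}"
  define F where "F y = {x \<in> S. p x = y}" for y
  assume "maximum_scattered q (L_graph (\<lambda>x. x ^ q + b * x ^ (q ^ 2)))"
  moreover have "L_graph (\<lambda>x. x ^ q + b * x ^ (q ^ 2)) = p ` S"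
    by (auto simp: L_graph_def p_def f_def S_def)
  ultimately have "card (p ` S) = (q ^ 5 - 1) div (q - 1)"
    by (simp add: maximum_scattered_def scattered_of_rank_def)
  moreover have "q - 1 dvd q ^ 5 - 1"
  proof -
    obtain m where m: "q = Suc m" using q_ge_2 by (cases q) auto
    have "q ^ 5 - 1 = m * (m ^ 4 + 5 * m ^ 3 + 10 * m ^ 2 + 10 * m + 5)"
      unfolding m by (simp add: eval_nat_numeral algebra_simps)
    then show ?thesis by (simp add: m)
  qed
  ultimately have card_pS: "card (p ` S) * (q - 1) = q ^ 5 - 1"
    by simp
  have card_S: "card S = q ^ 5 - 1"
    by (simp add: S_def card_Diff_singleton card_a)
  obtain l where l: "card {z. b * z ^ (q ^ 2) + z ^ q = l * z} = q ^ 2"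
    using exists_large_eigenspace[OF char card_a b] by blast
  define E where "E = {z. b * z ^ (q ^ 2) + z ^ q = l * z} - {0}"
  have "0 \<in> {z. b * z ^ (q ^ 2) + z ^ q = l * z}"
    using q_ge_2 by (simp add: power_0_left)
  then have card_E: "card E = q ^ 2 - 1"
    unfolding E_def by (simp add: l card_Diff_singleton)
  have "q ^ 2 > 1" using q_ge_2 by (intro one_less_power) simp_all
  then obtain e where e: "e \<in> E" using card_E by fastforce
  have p_E: "p z = point (1, l)" if "z \<in> E" for z
  proof -
    have "(z, f z) = scale_pair z (1, l)"
      using that by (auto simp: E_def f_def scale_pair_def mult.commute add.commute)
    then show ?thesis
      using that point_scale_pair[of z "(1, l)"] by (simp add: p_def E_def)
  qed
  have big: "q ^ 2 - 1 \<le> card (F (p e))"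
    unfolding card_E[symmetric]
    by (rule card_mono) (use p_E e in \<open>auto simp: F_def S_def E_def\<close>)
  have small: "q - 1 \<le> card (F y)" if y: "y \<in> p ` S" for y
  proof -
    obtain x where x: "x \<noteq> 0" "y = p x" using y by (auto simp: S_def)
    have "(\<lambda>c. c * x) ` (Fq q - {0}) \<subseteq> F y"
    proof (rule image_subsetI)
      fix c :: 'a assume "c \<in> Fq q - {0}"
      then have c: "c \<in> Fq q" "c \<noteq> 0" by simp_all
      from c have "c ^ q = c" by (simp add: Fq_def)
      then have "c ^ (q ^ 2) = c"
        by (simp add: power2_eq_square power_mult)
      with \<open>c ^ q = c\<close> have "f (c * x) = c * f x"
        by (simp add: f_def power_mult_distrib algebra_simps)
      then have "p (c * x) = p x"
        using point_scale_pair[of c "(x, f x)"] c by (simp add: p_def scale_pair_def)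
      then show "c * x \<in> F y"
        using x c by (simp add: F_def S_def)
    qed
    then have "card ((\<lambda>c. c * x) ` (Fq q - {0})) \<le> card (F y)"
      by (rule card_mono[rotated]) simp
    moreover have "card ((\<lambda>c. c * x) ` (Fq q - {0})) = card (Fq q - {0 :: 'a})"
      using x by (intro card_image) (simp add: inj_on_def)
    moreover have "0 \<in> (Fq q :: 'a set)"
      using q_ge_2 by (simp add: Fq_def)
    then have "card (Fq q - {0 :: 'a}) = q - 1"
      by (simp add: card_Diff_singleton card_Fq)
    ultimately show ?thesis by simp
  qed
  have peS: "p e \<in> p ` S" using e by (auto simp: S_def E_def)
  have "card S = (\<Sum>y\<in>p ` S. card (F y))"
    unfolding F_def using sum.image_gen[of S "\<lambda>_. 1 :: nat" p] by simp
  also have "\<dots> = card (F (p e)) + (\<Sum>y\<in>p ` S - {p e}. card (F y))"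
    using peS by (simp add: sum.remove)
  also have "\<dots> \<ge> (q ^ 2 - 1) + (card (p ` S) - 1) * (q - 1)"
  proof (rule add_mono[OF big])
    have "(card (p ` S) - 1) * (q - 1) = (\<Sum>y\<in>p ` S - {p e}. q - 1)"
      using peS by (simp add: card_Diff_singleton)
    also have "\<dots> \<le> (\<Sum>y\<in>p ` S - {p e}. card (F y))"
      by (rule sum_mono) (use small in auto)
    finally show "(card (p ` S) - 1) * (q - 1) \<le> (\<Sum>y\<in>p ` S - {p e}. card (F y))" .
  qed
  finally have "(q ^ 2 - 1) + (card (p ` S) - 1) * (q - 1) \<le> card (p ` S) * (q - 1)"
    by (simp only: card_S card_pS)
  moreover have "card (p ` S) > 0"
    using peS by (auto simp: card_gt_0_iff)
  then have "card (p ` S) * (q - 1) = (card (p ` S) - 1) * (q - 1) + (q - 1)"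
    by (cases "card (p ` S)") simp_all
  ultimately have "q ^ 2 - 1 \<le> q - 1" by simp
  moreover have "q < q ^ 2" using q_ge_2 by (simp add: power2_eq_square)
  ultimately show False using q_ge_2 by linarith
qed

theorem proposition3p3:
  fixes q :: nat and b :: "'a::{field,finite}"
  assumes "primepow q" and "q \<ge> 223"
    and "card (UNIV :: 'a set) = q ^ 5"
    and "b \<noteq> 0"
  shows "\<not> maximum_scattered q (L_graph (\<lambda>x. x ^ q + b * x ^ (q ^ 2)))"
proof -
  obtain k where "Factorial_Ring.prime CHAR('a)" "k > 0" "q = CHAR('a) ^ k"
    using CHAR_of_finite_field_primepow_card[OF assms(1,3)] .
  from L_graph_not_maximum_scattered[OF this assms(3,4)] show ?thesis .
qed

end
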